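(* Let $d\ge 2$. On the unweighted Bratteli diagram of finite $d$-ary trees (finite trees growing in the complete infinite $d$-ary tree $\mathcal S_d$), there is a unique MERW, and it is the $d$-ary search tree process, i.e. the Markov chain started from the single-vertex tree with transition probabilities $$p(\tau,\tau\sqcup\{v\})=\frac{1}{1+(d-1)|\tau|}$$ for each of the $1+(d-1)|\tau|$ nodes $v\in\mathcal S_d\setminus\tau$ such that $\tau\sqcup\{v\}$ is a $d$-ary tree.
   Context: $\mathcal S_d$ is the set of finite words over $\{1,\dots,d\}$, including the empty word $\emptyset$. A finite $d$-ary tree is a finite set $\tau\subset\mathcal S_d$ containing $\emptyset$ and closed under taking prefixes; $|\tau|$ is its cardinality. The Bratteli diagram $\mathbb X=\bigsqcup_{n\ge 0}\mathbb X_n$ has level $\mathbb X_n$ = set of $d$-ary trees of size $n+1$, root $\varnothing=\{\emptyset\}$, and an edge $\tau\nearrow\sigma$ iff $\sigma=\tau\sqcup\{v\}$ for some $v\notin\tau$. $d(\tau,\sigma)$ is the number of directed paths from $\tau$ to $\sigma$ and $d(\tau,\mathbb X_n)=\sum_{\sigma\in\mathbb X_n}d(\tau,\sigma)$. Definition of MERW: let $\varphi_n(\tau)=d(\tau,\mathbb X_n)/d(\varnothing,\mathbb X_n)$. If $\varphi^*$ is a pointwise limit of $\varphi_{n_k}$ along some subsequence $n_k\to\infty$, the associated MERW is the Markov chain started at $\varnothing$ with transition probabilities $p(\tau,\sigma)=\varphi^*(\sigma)/\varphi^*(\tau)$, $\tau\nearrow\sigma$, on $\{\varphi^*>0\}$.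 MERWs are the Markov chains arising in this way. *)

theory Defs
  imports "HOL-Probability.Probability" "HOL-Library.Sublist"
begin

type_synonym word = "nat list"
type_synonym tree = "word set"

definition dary_tree :: "nat \<Rightarrow> tree \<Rightarrow> bool" where
  "dary_tree d \<tau> \<longleftrightarrow>
     finite \<tau> \<and> \<tau> \<subseteq> lists {1..d} \<and> [] \<in> \<tau> \<and> (\<forall>v\<in>\<tau>. \<forall>u. prefix u v \<longrightarrow> u \<in> \<tau>)"

definition dary_trees :: "nat \<Rightarrow> tree set" where
  "dary_trees d = {\<tau>. dary_tree d \<tau>}"

definition level :: "nat \<Rightarrow> nat \<Rightarrow> tree set" where
  "level d n = {\<tau> \<in> dary_trees d. card \<tau> = n + 1}"

definition root :: tree where
  "root = {[]}"

definition edge :: "nat \<Rightarrow> tree \<Rightarrow> tree \<Rightarrow> bool" where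
  "edge d \<tau> \<sigma> \<longleftrightarrow> \<tau> \<in> dary_trees d \<and> \<sigma> \<in> dary_trees d \<and> (\<exists>v. v \<notin> \<tau> \<and> \<sigma> = insert v \<tau>)"

text \<open>The diagram has no multiple edges, so a directed path is determined by its list of
  vertices; the list with the single entry \<open>\<tau>\<close> is the path of length zero.\<close>

definition paths :: "nat \<Rightarrow> tree \<Rightarrow> tree \<Rightarrow> tree list set" where
  "paths d \<tau> \<sigma> =
     {ps. ps \<noteq> [] \<and> set ps \<subseteq> dary_trees d \<and> hd ps = \<tau> \<and> last ps = \<sigma> \<and> successively (edge d) ps}"

definition npaths :: "nat \<Rightarrow> tree \<Rightarrow> tree \<Rightarrow> nat" where
  "npaths d \<tau> \<sigma> = card (paths d \<tau> \<sigma>)"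

definition npaths_level :: "nat \<Rightarrow> tree \<Rightarrow> nat \<Rightarrow> nat" where
  "npaths_level d \<tau> n = (\<Sum>\<sigma>\<in>level d n. npaths d \<tau> \<sigma>)"

definition phi :: "nat \<Rightarrow> nat \<Rightarrow> tree \<Rightarrow> real" where
  "phi d n \<tau> = real (npaths_level d \<tau> n) / real (npaths_level d root n)"

definition subseq_limit :: "nat \<Rightarrow> (tree \<Rightarrow> real) \<Rightarrow> bool" where
  "subseq_limit d \<phi> \<longleftrightarrow>
     (\<exists>r :: nat \<Rightarrow> nat. strict_mono r \<and> (\<forall>\<tau>\<in>dary_trees d. (\<lambda>k. phi d (r k) \<tau>) \<longlonglongrightarrow> \<phi> \<tau>))"

text \<open>A Markov chain is represented by its law, a probability measure on the space of sequences
  of \<open>d\<close>-ary trees with the product \<open>\<sigma>\<close>-algebra. The state space \<open>S\<close> may be a proper subset of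
  the set of trees, so that the chain lies in \<open>S\<close> is required almost surely.\<close>

definition markov_chain_law ::
  "nat \<Rightarrow> tree set \<Rightarrow> tree \<Rightarrow> (tree \<Rightarrow> tree \<Rightarrow> real) \<Rightarrow> (nat \<Rightarrow> tree) measure \<Rightarrow> bool" where
  "markov_chain_law d S x0 p P \<longleftrightarrow>
     prob_space P \<and>
     sets P = sets (\<Pi>\<^sub>M n\<in>(UNIV :: nat set). count_space (dary_trees d)) \<and>
     (AE \<omega> in P. \<forall>n. \<omega> n \<in> S) \<and>
     (AE \<omega> in P. \<omega> 0 = x0) \<and>
     (\<forall>n (x :: nat \<Rightarrow> tree). \<forall>y\<in>S.
        measure P {\<omega> \<in> space P. \<forall>i\<le>n. \<omega> i = x i} > 0 \<longrightarrow>
        \<P>(\<omega> in P. \<omega> (Suc n) = y \<bar> \<forall>i\<le>n. \<omega> i = x i) = p (x n) y)"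

definition merw_states :: "nat \<Rightarrow> (tree \<Rightarrow> real) \<Rightarrow> tree set" where
  "merw_states d \<phi> = {\<tau> \<in> dary_trees d. \<phi> \<tau> > 0}"

definition merw_transition :: "nat \<Rightarrow> (tree \<Rightarrow> real) \<Rightarrow> tree \<Rightarrow> tree \<Rightarrow> real" where
  "merw_transition d \<phi> \<tau> \<sigma> = (if edge d \<tau> \<sigma> then \<phi> \<sigma> / \<phi> \<tau> else 0)"

definition is_MERW :: "nat \<Rightarrow> (nat \<Rightarrow> tree) measure \<Rightarrow> bool" where
  "is_MERW d P \<longleftrightarrow>
     (\<exists>\<phi>. subseq_limit d \<phi> \<and>
          markov_chain_law d (merw_states d \<phi>) root (merw_transition d \<phi>) P)"

definition search_tree_transition :: "nat \<Rightarrow> tree \<Rightarrow> tree \<Rightarrow> real" where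
  "search_tree_transition d \<tau> \<sigma> =
     (if edge d \<tau> \<sigma> then 1 / (1 + (real d - 1) * real (card \<tau>)) else 0)"

definition is_search_tree_process :: "nat \<Rightarrow> (nat \<Rightarrow> tree) measure \<Rightarrow> bool" where
  "is_search_tree_process d P \<longleftrightarrow>
     markov_chain_law d (dary_trees d) root (search_tree_transition d) P"

end

theory Submission
  imports Defs
begin

text \<open>A tree of size \<open>m\<close> has \<open>1 + (d - 1) * m\<close> successors, a number that depends on \<open>m\<close> only.
  Hence the number of paths from \<open>\<tau>\<close> to level \<open>n\<close> is the product of \<open>1 + (d - 1) * i\<close> over
  \<open>card \<tau> \<le> i \<le> n\<close>, and \<open>phi d n \<tau>\<close> does not depend on \<open>n\<close> once \<open>n + 1 \<ge> card \<tau>\<close>. All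
  subsequential limits therefore coincide, and their transition probabilities are uniform
  over the successors.\<close>

section \<open>Leaves that can be added to a tree\<close>

text \<open>Prefix closure only has to be checked for the new word, and every proper prefix of
  \<open>u @ [i]\<close> is already a prefix of \<open>u\<close>. Conversely \<open>v\<close> is
  non-empty because \<open>[] \<in> \<tau>\<close>, so its last letter can be split off.\<close>

lemma insert_in_dary_trees_iff:
  assumes "\<tau> \<in> dary_trees d" "v \<notin> \<tau>"
  shows "insert v \<tau> \<in> dary_trees d \<longleftrightarrow> (\<exists>u\<in>\<tau>. \<exists>i\<in>{1..d}. v = u @ [i])"
proof
  assume t: "insert v \<tau> \<in> dary_trees d"
  have "v \<noteq> []"
    using assms by (auto simp: dary_trees_def dary_tree_def)
  then obtain u i where v: "v = u @ [i]"
    by (metis rev_exhaust)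
  then have "prefix u v" "u \<noteq> v" by auto
  with t have "u \<in> \<tau>"
    by (auto simp: dary_trees_def dary_tree_def)
  moreover have "i \<in> {1..d}"
    using t v by (auto simp: dary_trees_def dary_tree_def)
  ultimately show "\<exists>u\<in>\<tau>. \<exists>i\<in>{1..d}. v = u @ [i]"
    using v by blast
next
  assume "\<exists>u\<in>\<tau>. \<exists>i\<in>{1..d}. v = u @ [i]"
  then obtain u i where v: "u \<in> \<tau>" "i \<in> {1..d}" "v = u @ [i]" by blast
  have "prefix w v \<Longrightarrow> w \<in> insert v \<tau>" for w
    using assms v by (auto simp: dary_trees_def dary_tree_def)
  then show "insert v \<tau> \<in> dary_trees d"
    using assms v by (auto simp: dary_trees_def dary_tree_def)
qed

text \<open>Double counting of the children \<open>u @ [i]\<close> of nodes of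
  \<open>\<tau>\<close>. With \<open>m = card \<tau>\<close> there are \<open>m * d\<close> of them,
  all distinct; each is either one of the \<open>m - 1\<close> non-root nodes of
  \<open>\<tau>\<close> or a node that can be added.\<close>

lemma card_extensions:
  assumes "1 \<le> d" and \<tau>: "\<tau> \<in> dary_trees d"
  shows "card {v. v \<notin> \<tau> \<and> insert v \<tau> \<in> dary_trees d} = 1 + (d - 1) * card \<tau>"
proof -
  let ?B = "{v. v \<notin> \<tau> \<and> insert v \<tau> \<in> dary_trees d}"
  let ?C = "(\<lambda>(u, i). u @ [i]) ` (\<tau> \<times> {1..d})"
  have fin: "finite \<tau>" and root: "[] \<in> \<tau>"
    using \<tau> by (auto simp: dary_trees_def dary_tree_def)
  have "\<tau> - {[]} \<subseteq> ?C"
  proof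
    fix v assume v: "v \<in> \<tau> - {[]}"
    then obtain u i where ui: "v = u @ [i]"
      by (metis DiffD2 insertI1 rev_exhaust)
    then have "prefix u v" by simp
    then have "u \<in> \<tau>" "i \<in> {1..d}"
      using v ui \<tau> by (auto simp: dary_trees_def dary_tree_def)
    then show "v \<in> ?C" using ui by force
  qed
  then have C: "?C = (\<tau> - {[]}) \<union> ?B"
  proof (intro equalityI subsetI)
    fix v assume "v \<in> ?C"
    then have "v \<noteq> []" "\<exists>u\<in>\<tau>. \<exists>i\<in>{1..d}. v = u @ [i]"
      by auto
    then show "v \<in> (\<tau> - {[]}) \<union> ?B"
      using insert_in_dary_trees_iff[OF \<tau>, of v] by blast
  next
    fix v assume v: "v \<in> (\<tau> - {[]}) \<union> ?B"
    show "v \<in> ?C"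
    proof (cases "v \<in> \<tau>")
      case True
      then show ?thesis
        using v \<open>\<tau> - {[]} \<subseteq> ?C\<close> by blast
    next
      case False
      then have "\<exists>u\<in>\<tau>. \<exists>i\<in>{1..d}. v = u @ [i]"
        using v insert_in_dary_trees_iff[OF \<tau>, of v] by blast
      then show ?thesis by auto
    qed
  qed
  have "finite ?C"
    using fin by simp
  then have "finite ?B"
    unfolding C by simp
  have "card ?C = card \<tau> * d"
    by (subst card_image) (auto simp: inj_on_def card_cartesian_product)
  moreover have "card ?C = (card \<tau> - 1) + card ?B"
    unfolding C using fin root \<open>finite ?B\<close> by (subst card_Un_disjoint) auto
  ultimately have "(card \<tau> - 1) + card ?B = card \<tau> * d" by simp
  moreover have "0 < card \<tau>"
    using fin root card_gt_0_iff by blast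
  \<comment> \<open>Here \<open>1 \<le> d\<close> makes the truncated subtraction
    \<open>d - 1\<close> exact.\<close>
  moreover have "card \<tau> * d = card \<tau> + (d - 1) * card \<tau>"
    using \<open>1 \<le> d\<close> by (cases d) (auto simp: algebra_simps)
  ultimately show ?thesis by simp
qed

lemma edge_set_eq:
  assumes "\<tau> \<in> dary_trees d"
  shows "{\<sigma>. edge d \<tau> \<sigma>} = (\<lambda>v. insert v \<tau>) ` {v. v \<notin> \<tau> \<and> insert v \<tau> \<in> dary_trees d}"
  using assms by (auto simp: edge_def)

lemma card_edge:
  assumes "1 \<le> d" "\<tau> \<in> dary_trees d"
  shows "card {\<sigma>. edge d \<tau> \<sigma>} = 1 + (d - 1) * card \<tau>"
  unfolding edge_set_eq[OF assms(2)]
  by (subst card_image) (use card_extensions[OF assms] in \<open>auto simp: inj_on_def\<close>)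

section \<open>Sizes along edges; finiteness of the levels and countability of the diagram\<close>

lemma edge_card: "edge d \<tau> \<sigma> \<Longrightarrow> card \<sigma> = Suc (card \<tau>)"
  by (auto simp: edge_def dary_trees_def dary_tree_def)

lemma edge_level: "edge d \<tau> \<sigma> \<Longrightarrow> \<tau> \<in> level d n \<Longrightarrow> \<sigma> \<in> level d (Suc n)"
  using edge_card[of d \<tau> \<sigma>] by (simp add: level_def edge_def)

lemma card_dary_tree_pos: "\<tau> \<in> dary_trees d \<Longrightarrow> 0 < card \<tau>"
  by (auto simp: dary_trees_def dary_tree_def card_gt_0_iff)

lemma root_in_dary_trees: "root \<in> dary_trees d"
  by (auto simp: root_def dary_trees_def dary_tree_def)

lemma root_in_level: "root \<in> level d 0"
  using root_in_dary_trees by (simp add: level_def root_def)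

text \<open>A word of length \<open>l\<close> in a tree brings along its \<open>l + 1\<close>
  distinct prefixes, so a tree with \<open>n + 1\<close> nodes only contains words of length at most
  \<open>n\<close>, and there are finitely many of those.\<close>

lemma finite_level: "finite (level d n)"
proof (rule finite_subset)
  show "level d n \<subseteq> Pow {w. set w \<subseteq> {1..d} \<and> length w \<le> n}"
  proof
    fix \<tau> assume \<tau>: "\<tau> \<in> level d n"
    have "length w \<le> n" if "w \<in> \<tau>" for w
    proof -
      have "set (prefixes w) \<subseteq> \<tau>"
        using \<tau> that by (auto simp: level_def dary_trees_def dary_tree_def)
      moreover have "card (set (prefixes w)) = Suc (length w)"
        by (simp add: distinct_card distinct_prefixes)
      ultimately show ?thesis
        using \<tau> card_mono[of \<tau> "set (prefixes w)"]
        by (simp add: level_def dary_trees_def dary_tree_def)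
    qed
    then show "\<tau> \<in> Pow {w. set w \<subseteq> {1..d} \<and> length w \<le> n}"
      using \<tau> by (fastforce simp: level_def dary_trees_def dary_tree_def in_lists_conv_set)
  qed
  show "finite (Pow {w. set w \<subseteq> {1..d} \<and> length w \<le> n})"
    by (simp add: finite_lists_length_le)
qed

lemma countable_dary_trees: "countable (dary_trees d)"
proof (rule countable_subset)
  show "dary_trees d \<subseteq> {A. finite A \<and> A \<subseteq> (UNIV :: word set)}"
    by (auto simp: dary_trees_def dary_tree_def)
qed (rule countable_Collect_finite_subset, simp)

section \<open>Counting paths\<close>

text \<open>Paths of fixed length with a free endpoint: unlike \<open>paths\<close>, this family
  admits recursion on the first edge. A path with \<open>k\<close> edges lists \<open>Suc k\<close>
  vertices.\<close>

definition walks :: "nat \<Rightarrow> nat \<Rightarrow> tree \<Rightarrow> tree list set" where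
  "walks d k \<tau> = {ps. ps \<noteq> [] \<and> set ps \<subseteq> dary_trees d \<and> hd ps = \<tau> \<and>
     length ps = Suc k \<and> successively (edge d) ps}"

lemma walks_0: "\<tau> \<in> dary_trees d \<Longrightarrow> walks d 0 \<tau> = {[\<tau>]}"
  by (auto simp: walks_def length_Suc_conv)

lemma walks_Suc:
  assumes "\<tau> \<in> dary_trees d"
  shows "walks d (Suc k) \<tau> = (\<Union>\<sigma>\<in>{\<sigma>. edge d \<tau> \<sigma>}. (#) \<tau> ` walks d k \<sigma>)"
proof (rule set_eqI)
  fix ps
  show "ps \<in> walks d (Suc k) \<tau> \<longleftrightarrow> ps \<in> (\<Union>\<sigma>\<in>{\<sigma>. edge d \<tau> \<sigma>}. (#) \<tau> ` walks d k \<sigma>)"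
    using assms by (cases ps) (auto simp: walks_def successively_Cons image_iff)
qed

text \<open>Every first step leads to a tree with one more node, so the number of continuations is
  the same for all successors and the counts multiply. Finiteness is carried through the induction
  because counting the disjoint union requires it.\<close>

lemma card_walks:
  assumes "1 \<le> d" "\<tau> \<in> dary_trees d"
  shows "finite (walks d k \<tau>) \<and> card (walks d k \<tau>) = (\<Prod>i<k. 1 + (d - 1) * (card \<tau> + i))"
  using assms(2)
proof (induction k arbitrary: \<tau>)
  case 0
  then show ?case by (simp add: walks_0)
next
  case (Suc k)
  \<comment> \<open>An infinite set has \<open>card\<close> 0, so a positive \<open>card\<close>
    already gives finiteness.\<close>
  have fin: "finite {\<sigma>. edge d \<tau> \<sigma>}"
    using card_edge[OF assms(1) Suc.prems] by (intro card_ge_0_finite) simp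
  have tree: "\<sigma> \<in> dary_trees d" if "edge d \<tau> \<sigma>" for \<sigma>
    using that by (simp add: edge_def)
  \<comment> \<open>The union is disjoint since the second vertex of a walk determines
    \<open>\<sigma>\<close>.\<close>
  have "card (walks d (Suc k) \<tau>) = (\<Sum>\<sigma>\<in>{\<sigma>. edge d \<tau> \<sigma>}. card ((#) \<tau> ` walks d k \<sigma>))"
    unfolding walks_Suc[OF Suc.prems]
    by (rule card_UN_disjoint) (use fin Suc.IH tree in \<open>auto simp: walks_def\<close>)
  also have "\<dots> = (\<Sum>\<sigma>\<in>{\<sigma>. edge d \<tau> \<sigma>}. \<Prod>i<k. 1 + (d - 1) * (card \<tau> + Suc i))"
    using Suc.IH tree by (intro sum.cong refl) (simp add: card_image edge_card)
  \<comment> \<open>The constant sum contributes the out-degree of \<open>\<tau>\<close>, which is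
    the factor at \<open>i = 0\<close>.\<close>
  also have "\<dots> = (\<Prod>i<Suc k. 1 + (d - 1) * (card \<tau> + i))"
    using card_edge[OF assms(1) Suc.prems] by (simp only: sum_constant prod.lessThan_Suc_shift) simp
  finally show ?case
    using fin Suc.IH tree walks_Suc[OF Suc.prems] by auto
qed

lemma successively_edge_card:
  "\<lbrakk>successively (edge d) ps; ps \<noteq> []\<rbrakk> \<Longrightarrow> card (last ps) + 1 = card (hd ps) + length ps"
  by (induction ps) (auto simp: successively_Cons edge_card)

text \<open>Size grows by one per edge, so ending in level \<open>n\<close> is the same as having
  exactly \<open>n + 1 - card \<tau>\<close> edges. In the boundary case
  \<open>card \<tau> = n + 1\<close> the product is empty and counts the path of length
  zero.\<close>

lemma npaths_level_eq:
  assumes "1 \<le> d" and \<tau>: "\<tau> \<in> dary_trees d" and n: "card \<tau> \<le> n + 1"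
  shows "npaths_level d \<tau> n = (\<Prod>i\<in>{card \<tau>..n}. 1 + (d - 1) * i)"
proof -
  let ?k = "n + 1 - card \<tau>"
  have W: "walks d ?k \<tau> = (\<Union>\<sigma>\<in>level d n. paths d \<tau> \<sigma>)"
  proof (intro equalityI subsetI)
    fix ps assume "ps \<in> walks d ?k \<tau>"
    then have ps: "ps \<noteq> []" "set ps \<subseteq> dary_trees d" "hd ps = \<tau>" "length ps = Suc ?k"
      "successively (edge d) ps" by (auto simp: walks_def)
    then have "card (last ps) = n + 1"
      using successively_edge_card[of d ps] n by simp
    then have "last ps \<in> level d n"
      using ps by (auto simp: level_def)
    then show "ps \<in> (\<Union>\<sigma>\<in>level d n. paths d \<tau> \<sigma>)"
      using ps by (auto simp: paths_def)
  next
    fix ps assume "ps \<in> (\<Union>\<sigma>\<in>level d n. paths d \<tau> \<sigma>)"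
    then have ps: "last ps \<in> level d n" "ps \<noteq> []" "set ps \<subseteq> dary_trees d" "hd ps = \<tau>"
      "successively (edge d) ps" by (auto simp: paths_def)
    then have "length ps = Suc ?k"
      using successively_edge_card[of d ps] n by (simp add: level_def)
    then show "ps \<in> walks d ?k \<tau>"
      using ps by (auto simp: walks_def)
  qed
  have fin: "finite (walks d ?k \<tau>)"
    using card_walks[OF \<open>1 \<le> d\<close> \<tau>] by blast
  have "finite (paths d \<tau> \<sigma>)" if "\<sigma> \<in> level d n" for \<sigma>
    by (rule finite_subset[OF _ fin]) (use W that in blast)
  then have "npaths_level d \<tau> n = card (walks d ?k \<tau>)"
    unfolding W npaths_level_def npaths_def
    by (intro card_UN_disjoint[symmetric]) (auto simp: finite_level paths_def)
  also have "\<dots> = (\<Prod>i<?k. 1 + (d - 1) * (card \<tau> + i))"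
    using card_walks[OF \<open>1 \<le> d\<close> \<tau>] by blast
  also have "\<dots> = (\<Prod>i\<in>{card \<tau>..n}. 1 + (d - 1) * i)"
    by (rule prod.reindex_bij_witness[where i = "\<lambda>i. i - card \<tau>" and j = "\<lambda>i. card \<tau> + i"]) auto
  finally show ?thesis .
qed

text \<open>For \<open>m \<ge> 1\<close> this is the reciprocal of the number of paths from the root
  to the level of trees with \<open>m\<close> nodes. It turns out to be the value of the limit
  function on such trees.\<close>

definition path_weight :: "nat \<Rightarrow> nat \<Rightarrow> real" where
  "path_weight d m = (\<Prod>i\<in>{1..<m}. 1 / (1 + (real d - 1) * real i))"

lemma growth_pos: "1 \<le> d \<Longrightarrow> 0 < 1 + (real d - 1) * real i"
  by (simp add: add_pos_nonneg)

lemma path_weight_pos: "1 \<le> d \<Longrightarrow> 0 < path_weight d m"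
  unfolding path_weight_def by (intro prod_pos) (simp add: growth_pos)

lemma path_weight_Suc:
  "0 < m \<Longrightarrow> path_weight d (Suc m) = path_weight d m / (1 + (real d - 1) * real m)"
  by (simp add: path_weight_def atLeastLessThanSuc)

text \<open>The count from the root is a product over \<open>{1..n}\<close>. Its factors from
  \<open>card \<tau>\<close> on are exactly the count from \<open>\<tau>\<close> and cancel, so
  \<open>n\<close> disappears from the quotient.\<close>

lemma phi_eq:
  assumes "1 \<le> d" and \<tau>: "\<tau> \<in> dary_trees d" and n: "card \<tau> \<le> n + 1"
  shows "phi d n \<tau> = path_weight d (card \<tau>)"
proof -
  let ?g = "\<lambda>i. 1 + (real d - 1) * real i"
  have eq: "real (npaths_level d \<sigma> n) = (\<Prod>i\<in>{card \<sigma>..n}. ?g i)"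
    if "\<sigma> \<in> dary_trees d" "card \<sigma> \<le> n + 1" for \<sigma>
    using npaths_level_eq[OF \<open>1 \<le> d\<close> that] \<open>1 \<le> d\<close> by (simp add: of_nat_diff)
  have pos: "0 < card \<tau>"
    using \<tau> by (rule card_dary_tree_pos)
  have "{1..n} = {1..<card \<tau>} \<union> {card \<tau>..n}"
    using n pos by auto
  then have "(\<Prod>i\<in>{1..n}. ?g i) = (\<Prod>i\<in>{1..<card \<tau>}. ?g i) * (\<Prod>i\<in>{card \<tau>..n}. ?g i)"
    by (simp add: prod.union_disjoint ivl_disj_int)
  then have "phi d n \<tau> = (\<Prod>i\<in>{card \<tau>..n}. ?g i) /
      ((\<Prod>i\<in>{1..<card \<tau>}. ?g i) * (\<Prod>i\<in>{card \<tau>..n}. ?g i))"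
    using eq[OF \<tau> n] eq[OF root_in_dary_trees] by (simp add: phi_def root_def)
  also have "\<dots> = 1 / (\<Prod>i\<in>{1..<card \<tau>}. ?g i)"
    using growth_pos[OF \<open>1 \<le> d\<close>]
    by (intro nonzero_divide_mult_cancel_right less_imp_neq[THEN not_sym] prod_pos) auto
  finally show ?thesis
    by (simp add: path_weight_def prod_dividef)
qed

text \<open>The sequence is eventually constant: \<open>k \<le> r k\<close> for strictly monotone
  \<open>r\<close>, so the size bound of \<open>phi_eq\<close> holds from
  \<open>k = card \<tau>\<close> on.\<close>

lemma phi_tendsto:
  assumes "1 \<le> d" "\<tau> \<in> dary_trees d" "strict_mono r"
  shows "(\<lambda>k. phi d (r k) \<tau>) \<longlonglongrightarrow> path_weight d (card \<tau>)"
proof (rule tendsto_eventually, rule eventually_sequentiallyI)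
  fix k assume "card \<tau> \<le> k"
  then have "card \<tau> \<le> r k + 1"
    using seq_suble[OF \<open>strict_mono r\<close>, of k] by simp
  then show "phi d (r k) \<tau> = path_weight d (card \<tau>)"
    by (rule phi_eq[OF assms(1,2)])
qed

text \<open>Uniqueness of limits gives one direction and the full sequence, \<open>r = id\<close>,
  the other. The values of \<open>\<phi>\<close> are determined on trees only, since
  \<open>subseq_limit\<close> leaves it free elsewhere.\<close>

lemma subseq_limit_iff:
  assumes "1 \<le> d"
  shows "subseq_limit d \<phi> \<longleftrightarrow> (\<forall>\<tau>\<in>dary_trees d. \<phi> \<tau> = path_weight d (card \<tau>))"
proof
  show "subseq_limit d \<phi> \<Longrightarrow> \<forall>\<tau>\<in>dary_trees d. \<phi> \<tau> = path_weight d (card \<tau>)"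
    unfolding subseq_limit_def using LIMSEQ_unique phi_tendsto[OF assms] by blast
  show "\<forall>\<tau>\<in>dary_trees d. \<phi> \<tau> = path_weight d (card \<tau>) \<Longrightarrow> subseq_limit d \<phi>"
    unfolding subseq_limit_def
    using phi_tendsto[OF assms _ strict_mono_id] by (intro exI[of _ id]) (auto simp: strict_mono_id)
qed

section \<open>The states and transition probabilities of a MERW\<close>

lemma merw_states_eq:
  assumes "1 \<le> d" "subseq_limit d \<phi>"
  shows "merw_states d \<phi> = dary_trees d"
  using assms(2) path_weight_pos[OF assms(1)]
  unfolding merw_states_def subseq_limit_iff[OF assms(1)] by auto

text \<open>Along an edge the two values of \<open>path_weight\<close> differ by the single factor
  belonging to \<open>card \<tau>\<close>. Off the edges both functions are 0, so equality holds for
  all arguments.\<close>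

lemma merw_transition_eq:
  assumes "1 \<le> d" "subseq_limit d \<phi>"
  shows "merw_transition d \<phi> = search_tree_transition d"
proof (intro ext)
  fix \<tau> \<sigma>
  show "merw_transition d \<phi> \<tau> \<sigma> = search_tree_transition d \<tau> \<sigma>"
  proof (cases "edge d \<tau> \<sigma>")
    case True
    then have "\<tau> \<in> dary_trees d" "\<sigma> \<in> dary_trees d"
      by (auto simp: edge_def)
    then show ?thesis
      using assms(2) True path_weight_pos[OF assms(1), of "card \<tau>"]
      unfolding subseq_limit_iff[OF assms(1)]
      by (simp add: merw_transition_def search_tree_transition_def edge_card[OF True]
          path_weight_Suc card_dary_tree_pos)
  qed (simp add: merw_transition_def search_tree_transition_def)
qed

text \<open>All subsequential limits yield the same states and transitions; that such a limit exists
  is what makes a search tree process a MERW.\<close>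

lemma is_MERW_iff:
  assumes "1 \<le> d"
  shows "is_MERW d P \<longleftrightarrow> is_search_tree_process d P"
proof -
  have "subseq_limit d (\<lambda>\<tau>. path_weight d (card \<tau>))"
    using assms by (simp add: subseq_limit_iff)
  then show ?thesis
    unfolding is_MERW_def is_search_tree_process_def
    using merw_states_eq[OF assms] merw_transition_eq[OF assms] by auto
qed

section \<open>Uniqueness of the law\<close>

abbreviation path_space :: "nat \<Rightarrow> (nat \<Rightarrow> tree) measure" where
  "path_space d \<equiv> \<Pi>\<^sub>M n\<in>(UNIV :: nat set). count_space (dary_trees d)"

lemma space_path_space: "space (path_space d) = UNIV \<rightarrow> dary_trees d"
  by (simp add: space_PiM PiE_UNIV_domain Pi_def)

lemma cylinder_sets:
  assumes "sets P = sets (path_space d)"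
  shows "{\<omega> \<in> space P. \<forall>i\<le>n. \<omega> i = x i} \<in> sets P"
proof -
  have sp: "space P = space (path_space d)"
    by (rule sets_eq_imp_space_eq[OF assms])
  have "{\<omega> \<in> space (path_space d). \<omega> i = x i} \<in> sets (path_space d)" for i
  proof -
    \<comment> \<open>The intersection with \<open>dary_trees d\<close> is needed because
      \<open>x i\<close> may fail to be a tree, and then its singleton is not measurable in the
      coordinate space.\<close>
    have "{\<omega> \<in> space (path_space d). \<omega> i = x i} =
        (\<lambda>\<omega>. \<omega> i) -` ({x i} \<inter> dary_trees d) \<inter> space (path_space d)"
      by (auto simp: space_path_space)
    also have "\<dots> \<in> sets (path_space d)"
      by (rule measurable_sets[OF measurable_component_singleton]) auto
    finally show ?thesis .
  qed
  then have "{\<omega> \<in> space (path_space d). \<forall>i\<in>{..n}. \<omega> i = x i} \<in> sets (path_space d)"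
    by (intro sets.sets_Collect_finite_All) auto
  then show ?thesis
    by (simp add: assms sp)
qed

text \<open>Laws on the product are determined by finite-dimensional boxes. As there are only
  countably many trees, each box is a countable disjoint union of cylinders fixing the coordinates
  up to some \<open>n\<close>.\<close>

lemma path_measure_eqI:
  assumes P: "prob_space P" "sets P = sets (path_space d)"
    and Q: "prob_space Q" "sets Q = sets (path_space d)"
    and eq: "\<And>n x. measure P {\<omega> \<in> space P. \<forall>i\<le>n. \<omega> i = x i} =
      measure Q {\<omega> \<in> space Q. \<forall>i\<le>n. \<omega> i = x i}"
  shows "P = Q"
proof (rule measure_eqI_PiM_infinite[OF P(2) Q(2)])
  interpret P: prob_space P by fact
  interpret Q: prob_space Q by fact
  show "finite_measure P" by (rule P.finite_measure_axioms)
  fix A and J :: "nat set"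
  assume J: "finite J" and A: "\<And>i. i \<in> J \<Longrightarrow> A i \<in> sets (count_space (dary_trees d))"
  obtain n where n: "J \<subseteq> {..n}"
    using J by (meson atMost_iff finite_nat_set_iff_bounded_le subsetI)
  define cyl where "cyl = (\<lambda>x. {\<omega> \<in> space (path_space d). \<forall>i\<le>n. \<omega> i = x i})"
  \<comment> \<open>The indices are extensional functions on \<open>{..n}\<close>, so two different
    ones differ at some \<open>i \<le> n\<close> and give disjoint cylinders.\<close>
  define X where "X = {x \<in> {..n} \<rightarrow>\<^sub>E dary_trees d. \<forall>j\<in>J. x j \<in> A j}"
  have sp: "space P = space (path_space d)" "space Q = space (path_space d)"
    using P(2) Q(2) by (auto dest: sets_eq_imp_space_eq)
  have "countable X"
    unfolding X_def
    by (rule countable_subset[of _ "{..n} \<rightarrow>\<^sub>E dary_trees d"])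
      (auto intro!: countable_PiE countable_dary_trees)
  have disj: "disjoint_family_on cyl X"
  proof (unfold disjoint_family_on_def, intro ballI impI)
    fix x y assume "x \<in> X" "y \<in> X" "x \<noteq> y"
    then obtain i where "i \<le> n" "x i \<noteq> y i"
      using PiE_ext[of x "{..n}" "\<lambda>_. dary_trees d" y] by (auto simp: X_def)
    then show "cyl x \<inter> cyl y = {}"
      by (auto simp: cyl_def)
  qed
  have emb: "prod_emb UNIV (\<lambda>_. count_space (dary_trees d)) J (Pi\<^sub>E J A) = (\<Union>x\<in>X. cyl x)"
  proof (intro equalityI subsetI)
    fix \<omega> assume "\<omega> \<in> prod_emb UNIV (\<lambda>_. count_space (dary_trees d)) J (Pi\<^sub>E J A)"
    then have "\<omega> \<in> UNIV \<rightarrow> dary_trees d" "\<forall>j\<in>J. \<omega> j \<in> A j"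
      by (auto simp: prod_emb_def PiE_UNIV_domain Pi_def restrict_def PiE_def split: if_splits)
    then have "restrict \<omega> {..n} \<in> X" "\<omega> \<in> cyl (restrict \<omega> {..n})"
      using n by (auto simp: X_def cyl_def space_path_space)
    then show "\<omega> \<in> (\<Union>x\<in>X. cyl x)" by blast
  next
    fix \<omega> assume "\<omega> \<in> (\<Union>x\<in>X. cyl x)"
    then obtain x where x: "x \<in> X" "\<omega> \<in> cyl x" by blast
    then have "\<forall>j\<in>J. \<omega> j \<in> A j"
      using n by (auto simp: X_def cyl_def)
    then show "\<omega> \<in> prod_emb UNIV (\<lambda>_. count_space (dary_trees d)) J (Pi\<^sub>E J A)"
      using x by (auto simp: prod_emb_def cyl_def space_path_space PiE_UNIV_domain)
  qed
  have cyl_sets: "cyl x \<in> sets P" "cyl x \<in> sets Q" for x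
    using cylinder_sets[OF P(2), of n x] cylinder_sets[OF Q(2), of n x]
    unfolding cyl_def sp .
  have "emeasure P (\<Union>x\<in>X. cyl x) = (\<integral>\<^sup>+x. emeasure P (cyl x) \<partial>count_space X)"
    by (rule emeasure_UN_countable[OF cyl_sets(1) \<open>countable X\<close> disj])
  also have "\<dots> = (\<integral>\<^sup>+x. emeasure Q (cyl x) \<partial>count_space X)"
    using eq by (simp add: P.emeasure_eq_measure Q.emeasure_eq_measure cyl_def sp)
  also have "\<dots> = emeasure Q (\<Union>x\<in>X. cyl x)"
    by (rule emeasure_UN_countable[OF cyl_sets(2) \<open>countable X\<close> disj, symmetric])
  finally show "emeasure P (prod_emb UNIV (\<lambda>_. count_space (dary_trees d)) J (Pi\<^sub>E J A)) =
      emeasure Q (prod_emb UNIV (\<lambda>_. count_space (dary_trees d)) J (Pi\<^sub>E J A))"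
    by (simp only: emb)
qed

text \<open>Naming the next state \<open>x (Suc n)\<close> turns the joint event into the next
  cylinder of the same sequence, so conditional probabilities become ratios of cylinder
  probabilities.\<close>

lemma cond_prob_next:
  "\<P>(\<omega> in P. \<omega> (Suc n) = x (Suc n) \<bar> \<forall>i\<le>n. \<omega> i = x i) =
    measure P {\<omega> \<in> space P. \<forall>i\<le>Suc n. \<omega> i = x i} / measure P {\<omega> \<in> space P. \<forall>i\<le>n. \<omega> i = x i}"
proof -
  have "{\<omega> \<in> space P. \<omega> (Suc n) = x (Suc n) \<and> (\<forall>i\<le>n. \<omega> i = x i)} =
      {\<omega> \<in> space P. \<forall>i\<le>Suc n. \<omega> i = x i}"
    by (auto simp: le_Suc_eq)
  then show ?thesis
    by (simp add: cond_prob_def)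
qed

section \<open>Cylinder probabilities of a Markov chain\<close>

lemma markov_chain_law_cylinder_0:
  assumes "markov_chain_law d (dary_trees d) x0 p P"
  shows "measure P {\<omega> \<in> space P. \<forall>i\<le>0. \<omega> i = x i} = (if x 0 = x0 then 1 else 0)"
proof -
  interpret prob_space P
    using assms by (simp add: markov_chain_law_def)
  have start: "AE \<omega> in P. \<omega> 0 = x0" and sets: "sets P = sets (path_space d)"
    using assms by (auto simp: markov_chain_law_def)
  show ?thesis
  proof (cases "x 0 = x0")
    case True
    then show ?thesis
      using start cylinder_sets[OF sets, of 0 x] by (simp add: prob_Collect_eq_1)
  next
    case False
    then have "AE \<omega> in P. \<not> (\<forall>i\<le>0. \<omega> i = x i)"
      using start by auto
    then show ?thesis
      using False prob_Collect_eq_0[OF cylinder_sets[OF sets, of 0 x]] by simp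
  qed
qed

text \<open>This is the multiplication rule. If the conditioning cylinder is null, so is the smaller
  one by monotonicity; if \<open>x (Suc n)\<close> is not a tree, the cylinder is empty.\<close>

lemma markov_chain_law_cylinder_Suc:
  assumes "markov_chain_law d (dary_trees d) x0 p P"
  shows "measure P {\<omega> \<in> space P. \<forall>i\<le>Suc n. \<omega> i = x i} =
    (if x (Suc n) \<in> dary_trees d
     then p (x n) (x (Suc n)) * measure P {\<omega> \<in> space P. \<forall>i\<le>n. \<omega> i = x i} else 0)"
    (is "?m (Suc n) = _")
proof -
  interpret prob_space P
    using assms by (simp add: markov_chain_law_def)
  have sets: "sets P = sets (path_space d)"
    using assms by (auto simp: markov_chain_law_def)
  show ?thesis
  proof (cases "x (Suc n) \<in> dary_trees d")
    case x: True
    show ?thesis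
    proof (cases "?m n = 0")
      case True
      have "?m (Suc n) \<le> ?m n"
        by (rule finite_measure_mono[OF _ cylinder_sets[OF sets]]) auto
      then show ?thesis
        using True by (simp add: measure_le_0_iff)
    next
      case False
      then have "?m n > 0"
        by (simp add: zero_less_measure_iff)
      then have "\<P>(\<omega> in P. \<omega> (Suc n) = x (Suc n) \<bar> \<forall>i\<le>n. \<omega> i = x i) = p (x n) (x (Suc n))"
        using assms x unfolding markov_chain_law_def by blast
      then show ?thesis
        using False x by (simp add: cond_prob_next field_simps)
    qed
  next
    case False
    then have empty: "{\<omega> \<in> space P. \<forall>i\<le>Suc n. \<omega> i = x i} = {}"
      using sets_eq_imp_space_eq[OF sets]
      by (auto simp: space_path_space Pi_iff) (metis order_refl)
    show ?thesis
      unfolding empty using False by simp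
  qed
qed

text \<open>The initial value and the recursion for cylinder probabilities involve only
  \<open>x0\<close> and \<open>p\<close>, hence agree for both laws.\<close>

lemma markov_chain_law_unique:
  assumes P: "markov_chain_law d (dary_trees d) x0 p P"
    and Q: "markov_chain_law d (dary_trees d) x0 p Q"
  shows "P = Q"
proof (rule path_measure_eqI)
  show "measure P {\<omega> \<in> space P. \<forall>i\<le>n. \<omega> i = x i} = measure Q {\<omega> \<in> space Q. \<forall>i\<le>n. \<omega> i = x i}" for n x
  proof (induction n)
    case 0
    show ?case
      unfolding markov_chain_law_cylinder_0[OF P] markov_chain_law_cylinder_0[OF Q] ..
  next
    case (Suc n)
    then show ?case
      unfolding markov_chain_law_cylinder_Suc[OF P] markov_chain_law_cylinder_Suc[OF Q] by simp
  qed
qed (use P Q in \<open>auto simp: markov_chain_law_def\<close>)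

section \<open>Existence of the search tree process\<close>

text \<open>Every tree with \<open>n + 1\<close> nodes has \<open>1 + (d - 1) * (n + 1)\<close> successors, so the
  process can be driven by independent uniform choices made in advance.\<close>

definition choices :: "nat \<Rightarrow> nat \<Rightarrow> nat" where
  "choices d n = 1 + (d - 1) * Suc n"

definition choice_space :: "nat \<Rightarrow> (nat \<Rightarrow> nat) measure" where
  "choice_space d = (\<Pi>\<^sub>M n\<in>UNIV. uniform_count_measure {..<choices d n})"

text \<open>\<open>from_nat_into\<close> numbers the successors of the current tree. On a finite set
  with \<open>k\<close> elements it is a bijection from \<open>{..<k}\<close>, so a uniform
  \<open>\<xi> n\<close> selects a uniform successor.\<close>

primrec grow :: "nat \<Rightarrow> (nat \<Rightarrow> nat) \<Rightarrow> nat \<Rightarrow> tree" where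
  "grow d \<xi> 0 = root"
| "grow d \<xi> (Suc n) = from_nat_into {\<sigma>. edge d (grow d \<xi> n) \<sigma>} (\<xi> n)"

definition search_tree_law :: "nat \<Rightarrow> (nat \<Rightarrow> tree) measure" where
  "search_tree_law d = distr (choice_space d) (path_space d) (grow d)"

section \<open>The product space of uniform choices\<close>

lemma choices_pos: "0 < choices d n"
  by (simp add: choices_def)

lemma product_prob_space_choices:
  "product_prob_space (\<lambda>n. uniform_count_measure {..<choices d n})"
proof -
  have "prob_space (uniform_count_measure {..<choices d n})" for n
    using choices_pos[of d n] by (intro prob_space_uniform_count_measure) (auto simp: lessThan_empty_iff)
  then show ?thesis
    by (auto simp: product_prob_space_def product_sigma_finite_def product_prob_space_axioms_def
        prob_space_imp_sigma_finite)
qed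

lemma space_choice_space: "space (choice_space d) = {\<xi>. \<forall>n. \<xi> n < choices d n}"
  by (auto simp: choice_space_def space_PiM PiE_UNIV_domain space_uniform_count_measure)

lemma prob_space_choice_space: "prob_space (choice_space d)"
proof -
  interpret product_prob_space "\<lambda>n. uniform_count_measure {..<choices d n}" UNIV
    by (rule product_prob_space_choices)
  show ?thesis
    unfolding choice_space_def by (rule P.prob_space_axioms)
qed

text \<open>This is independence of the coordinates. The bound \<open>i < n\<close> is strict
  because the first \<open>n\<close> choices determine the trees at times \<open>0\<close> to
  \<open>n\<close>.\<close>

lemma measure_choices:
  assumes "\<And>i. i < n \<Longrightarrow> c i < choices d i"
  shows "measure (choice_space d) {\<xi> \<in> space (choice_space d). \<forall>i<n. \<xi> i = c i} =
    (\<Prod>i<n. 1 / real (choices d i))"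
proof -
  interpret product_prob_space "\<lambda>n. uniform_count_measure {..<choices d n}" UNIV
    by (rule product_prob_space_choices)
  have "emeasure (choice_space d) {\<xi> \<in> space (choice_space d). \<forall>i\<in>{..<n}. \<xi> i \<in> {c i}} =
      (\<Prod>i<n. emeasure (uniform_count_measure {..<choices d i}) {c i})"
    unfolding choice_space_def using assms
    by (intro emeasure_PiM_Collect) (auto simp: sets_uniform_count_measure)
  also have "\<dots> = (\<Prod>i<n. ennreal (1 / real (choices d i)))"
    using assms by (intro prod.cong refl) (simp add: emeasure_uniform_count_measure)
  also have "\<dots> = ennreal (\<Prod>i<n. 1 / real (choices d i))"
    by (simp add: prod_ennreal)
  finally show ?thesis
    by (simp add: measure_def prod_nonneg lessThan_def)
qed

text \<open>\<open>from_nat_into\<close> returns a member of a non-empty set for every index. Hence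
  \<open>grow\<close> follows edges for every \<open>\<xi>\<close>, also outside the choice
  space.\<close>

lemma edge_from_nat_into:
  assumes "1 \<le> d" "\<tau> \<in> dary_trees d"
  shows "edge d \<tau> (from_nat_into {\<sigma>. edge d \<tau> \<sigma>} k)"
proof -
  have "{\<sigma>. edge d \<tau> \<sigma>} \<noteq> {}"
    using card_edge[OF assms] by (metis card.empty add_is_0 zero_neq_one)
  from from_nat_into[OF this, of k] show ?thesis by simp
qed

lemma grow_in_level: "1 \<le> d \<Longrightarrow> grow d \<xi> n \<in> level d n"
proof (induction n)
  case 0
  then show ?case by (simp add: root_in_level)
next
  case (Suc n)
  then have "grow d \<xi> n \<in> level d n" by simp
  moreover from this have "edge d (grow d \<xi> n) (grow d \<xi> (Suc n))"
    using edge_from_nat_into[OF Suc.prems] by (simp add: level_def)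
  ultimately show ?case
    by (rule edge_level[rotated])
qed

lemma grow_in_dary_trees: "1 \<le> d \<Longrightarrow> grow d \<xi> n \<in> dary_trees d"
  using grow_in_level[of d \<xi> n] by (simp add: level_def)

text \<open>The successor set depends on the previous tree, which takes countably many values. For
  each fixed value the next tree is a function of one discrete coordinate, and the countable case
  split preserves measurability.\<close>

lemma measurable_grow:
  assumes "1 \<le> d"
  shows "grow d \<in> measurable (choice_space d) (path_space d)"
proof -
  have "(\<lambda>\<xi>. grow d \<xi> n) \<in> measurable (choice_space d) (count_space (dary_trees d))" for n
  proof (induction n)
    case 0
    then show ?case using root_in_dary_trees by simp
  next
    case (Suc n)
    have "(\<lambda>\<xi>. from_nat_into {\<sigma>. edge d \<tau> \<sigma>} (\<xi> n))
        \<in> measurable (choice_space d) (count_space (dary_trees d))"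
      if "\<tau> \<in> dary_trees d" for \<tau>
    proof (rule measurable_compose[of "\<lambda>\<xi>. \<xi> n"])
      show "(\<lambda>\<xi>. \<xi> n) \<in> measurable (choice_space d) (uniform_count_measure {..<choices d n})"
        unfolding choice_space_def by (rule measurable_component_singleton) simp
      have "from_nat_into {\<sigma>. edge d \<tau> \<sigma>} k \<in> dary_trees d" for k
        using edge_from_nat_into[OF assms that, of k] unfolding edge_def by blast
      then show "from_nat_into {\<sigma>. edge d \<tau> \<sigma>}
          \<in> measurable (uniform_count_measure {..<choices d n}) (count_space (dary_trees d))"
        by (simp add: measurable_def sets_uniform_count_measure space_uniform_count_measure)
    qed
    then show ?case
      unfolding grow.simps
      by (rule measurable_compose_countable'[OF _ Suc.IH countable_dary_trees])
  qed
  then show ?thesis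
    using grow_in_dary_trees[OF assms]
    by (intro measurable_PiM_single'[where f = "\<lambda>i \<xi>. grow d \<xi> i"]) (simp_all add: PiE_UNIV_domain)
qed

text \<open>If \<open>x\<close> follows edges from the root, each of its first \<open>n\<close>
  steps is produced by exactly one choice, so the event is a cylinder of choices. Otherwise it is
  empty, as \<open>grow\<close> starts at the root and follows edges.\<close>

lemma measure_grow_cylinder:
  assumes "1 \<le> d"
  shows "measure (search_tree_law d) {\<omega> \<in> space (search_tree_law d). \<forall>i\<le>n. \<omega> i = x i} =
    (if x 0 = root \<and> (\<forall>i<n. edge d (x i) (x (Suc i))) then \<Prod>i<n. 1 / real (choices d i) else 0)"
proof -
  have sp: "space (search_tree_law d) = space (path_space d)"
    and st: "sets (search_tree_law d) = sets (path_space d)"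
    by (simp_all add: search_tree_law_def)
  define E where "E = {\<xi> \<in> space (choice_space d). \<forall>i\<le>n. grow d \<xi> i = x i}"
  have "measure (search_tree_law d) {\<omega> \<in> space (search_tree_law d). \<forall>i\<le>n. \<omega> i = x i} =
      measure (choice_space d) (grow d -` {\<omega> \<in> space (search_tree_law d). \<forall>i\<le>n. \<omega> i = x i}
        \<inter> space (choice_space d))"
    using cylinder_sets[OF st, of n x] st unfolding search_tree_law_def
    by (intro measure_distr[OF measurable_grow[OF assms]]) simp
  also have "grow d -` {\<omega> \<in> space (search_tree_law d). \<forall>i\<le>n. \<omega> i = x i}
        \<inter> space (choice_space d) = E"
    using grow_in_dary_trees[OF assms] by (auto simp: E_def sp space_path_space)
  also have "measure (choice_space d) E =
    (if x 0 = root \<and> (\<forall>i<n. edge d (x i) (x (Suc i))) then \<Prod>i<n. 1 / real (choices d i) else 0)"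
  proof (cases "x 0 = root \<and> (\<forall>i<n. edge d (x i) (x (Suc i)))")
    case True
    \<comment> \<open>Being in level \<open>i\<close>, the tree \<open>x i\<close> has
      \<open>i + 1\<close> nodes and therefore exactly \<open>choices d i\<close>
      successors.\<close>
    have x: "x i \<in> level d i" if "i \<le> n" for i
      using that by (induction i) (use True in \<open>auto simp: root_in_level Suc_le_eq intro!: edge_level[of d "x _"]\<close>)
    have bij: "bij_betw (from_nat_into {\<sigma>. edge d (x i) \<sigma>}) {..<choices d i} {\<sigma>. edge d (x i) \<sigma>}"
      if "i < n" for i
    proof -
      have "card {\<sigma>. edge d (x i) \<sigma>} = choices d i"
        using x[of i] that card_edge[OF assms] by (simp add: level_def choices_def)
      then show ?thesis
        using bij_betw_from_nat_into_finite[of "{\<sigma>. edge d (x i) \<sigma>}"] choices_pos[of d i]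
        by (simp add: card_ge_0_finite)
    qed
    have "\<exists>k<choices d i. from_nat_into {\<sigma>. edge d (x i) \<sigma>} k = x (Suc i)" if "i < n" for i
    proof -
      have "x (Suc i) \<in> from_nat_into {\<sigma>. edge d (x i) \<sigma>} ` {..<choices d i}"
        using bij_betw_imp_surj_on[OF bij[OF that]] True that by simp
      then show ?thesis by auto
    qed
    \<comment> \<open>The sequence \<open>c\<close> encodes the path \<open>x\<close> as choices, by
      surjectivity of the enumerations; injectivity will show that no other first \<open>n\<close>
      choices produce it.\<close>
    then obtain c where c: "\<And>i. i < n \<Longrightarrow> c i < choices d i"
        "\<And>i. i < n \<Longrightarrow> from_nat_into {\<sigma>. edge d (x i) \<sigma>} (c i) = x (Suc i)"
      by metis
    have "E = {\<xi> \<in> space (choice_space d). \<forall>i<n. \<xi> i = c i}"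
    proof (intro equalityI subsetI CollectI conjI allI impI)
      fix \<xi> assume "\<xi> \<in> {\<xi> \<in> space (choice_space d). \<forall>i<n. \<xi> i = c i}"
      then have \<xi>: "\<xi> \<in> space (choice_space d)" "\<And>i. i < n \<Longrightarrow> \<xi> i = c i" by auto
      have "grow d \<xi> i = x i" if "i \<le> n" for i
        using that by (induction i) (use True c \<xi> in auto)
      then show "\<xi> \<in> E"
        using \<xi> by (simp add: E_def)
    next
      fix \<xi> i assume \<xi>: "\<xi> \<in> E" and "i < n"
      then have "grow d \<xi> i = x i" "grow d \<xi> (Suc i) = x (Suc i)" "\<xi> i < choices d i"
        by (simp_all add: E_def space_choice_space Suc_leI del: grow.simps)
      then show "\<xi> i = c i"
        using bij_betw_imp_inj_on[OF bij[OF \<open>i < n\<close>]] c[OF \<open>i < n\<close>]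
        by (intro inj_onD[of "from_nat_into {\<sigma>. edge d (x i) \<sigma>}"]) auto
    qed (simp add: E_def)
    then show ?thesis
      using True measure_choices[of n c d] c(1) by simp
  next
    case False
    have "\<xi> \<notin> E" for \<xi>
    proof
      assume "\<xi> \<in> E"
      then have \<xi>: "grow d \<xi> i = x i" if "i \<le> n" for i
        using that by (simp add: E_def)
      have "edge d (grow d \<xi> i) (grow d \<xi> (Suc i))" for i
        using edge_from_nat_into[OF assms grow_in_dary_trees[OF assms]] by simp
      then have "edge d (x i) (x (Suc i))" if "i < n" for i
        using \<xi>[of i] \<xi>[of "Suc i"] that by (metis Suc_leI less_imp_le)
      moreover have "x 0 = root"
        using \<xi>[of 0] by simp
      ultimately show False
        using False by blast
    qed
    then have "E = {}" by blast
    then show ?thesis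
      unfolding if_not_P[OF False] by simp
  qed
  finally show ?thesis .
qed

text \<open>The conditional probability is a quotient of two products of
  \<open>1 / choices d i\<close>, of which only the factor at \<open>i = n\<close> survives, or it
  is 0 if the last step is not an edge.\<close>

lemma is_search_tree_process_search_tree_law:
  assumes "1 \<le> d"
  shows "is_search_tree_process d (search_tree_law d)"
  unfolding is_search_tree_process_def markov_chain_law_def
proof (intro conjI allI ballI impI)
  let ?P = "search_tree_law d"
  show "sets ?P = sets (path_space d)"
    by (simp add: search_tree_law_def)
  show "prob_space ?P"
    unfolding search_tree_law_def
    by (rule prob_space.prob_space_distr[OF prob_space_choice_space measurable_grow[OF assms]])
  then interpret prob_space ?P .
  have space: "space ?P = UNIV \<rightarrow> dary_trees d"
    by (simp add: search_tree_law_def space_path_space)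
  show "AE \<omega> in ?P. \<forall>n. \<omega> n \<in> dary_trees d"
    by (rule AE_I2) (auto simp: space)
  have "{\<omega> \<in> space ?P. \<omega> 0 = root} \<in> events"
    using cylinder_sets[OF \<open>sets ?P = sets (path_space d)\<close>, of 0 "\<lambda>_. root"] by simp
  moreover have "\<P>(\<omega> in ?P. \<omega> 0 = root) = 1"
    using measure_grow_cylinder[OF assms, of 0 "\<lambda>_. root"] by simp
  ultimately show "AE \<omega> in ?P. \<omega> 0 = root"
    by (simp add: prob_Collect_eq_1)
  fix n and x :: "nat \<Rightarrow> tree" and y
  assume "y \<in> dary_trees d" and pos: "0 < measure ?P {\<omega> \<in> space ?P. \<forall>i\<le>n. \<omega> i = x i}"
  \<comment> \<open>Storing \<open>y\<close> as the entry at \<open>Suc n\<close> leaves the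
    conditioning event unchanged and allows \<open>cond_prob_next\<close> to be applied.\<close>
  define x' where "x' = x(Suc n := y)"
  \<comment> \<open>A cylinder of positive probability must be a path from the root; this fixes the
    size of \<open>x n\<close> as \<open>n + 1\<close> and hence its out-degree as
    \<open>choices d n\<close>.\<close>
  have x: "x 0 = root" "\<And>i. i < n \<Longrightarrow> edge d (x i) (x (Suc i))"
    using pos unfolding measure_grow_cylinder[OF assms] by (auto split: if_splits)
  have x': "(\<forall>i\<le>n. \<omega> i = x' i) \<longleftrightarrow> (\<forall>i\<le>n. \<omega> i = x i)" for \<omega> :: "nat \<Rightarrow> tree"
    by (auto simp: x'_def)
  have "card (x n) = Suc n"
  proof -
    have "i \<le> n \<Longrightarrow> card (x i) = Suc i" for i
      by (induction i) (use x in \<open>auto simp: root_def edge_card[OF x(2)] Suc_le_eq\<close>)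
    then show ?thesis by simp
  qed
  then have ch: "real (choices d n) = 1 + (real d - 1) * real (card (x n))"
    using assms by (simp add: choices_def of_nat_diff) argo
  have path: "x' 0 = root" "(\<forall>i<n. edge d (x' i) (x' (Suc i)))"
    "(\<forall>i<Suc n. edge d (x' i) (x' (Suc i))) \<longleftrightarrow> edge d (x n) y"
    using x by (auto simp: x'_def less_Suc_eq)
  have "choices d i \<noteq> 0" for i
    using choices_pos[of d i] by simp
  then show "\<P>(\<omega> in ?P. \<omega> (Suc n) = y \<bar> \<forall>i\<le>n. \<omega> i = x i) = search_tree_transition d (x n) y"
    using cond_prob_next[of ?P n x'] path unfolding measure_grow_cylinder[OF assms] x'
    by (auto simp: x'_def search_tree_transition_def ch)
qed

section \<open>Existence, uniqueness and identification of the MERW\<close>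

theorem proposition4p1:
  fixes d :: nat
  assumes "d \<ge> 2"
  shows "(\<exists>!P. is_MERW d P) \<and>
    (\<forall>P. is_MERW d P \<longleftrightarrow> is_search_tree_process d P) \<and>
    (\<forall>\<phi>. subseq_limit d \<phi> \<longrightarrow>
       merw_states d \<phi> = dary_trees d \<and>
       (\<forall>\<tau>\<in>dary_trees d. \<forall>\<sigma>\<in>dary_trees d. merw_transition d \<phi> \<tau> \<sigma> = search_tree_transition d \<tau> \<sigma>)) \<and>
    (\<forall>\<tau>\<in>dary_trees d. card {v. v \<notin> \<tau> \<and> insert v \<tau> \<in> dary_trees d} = 1 + (d - 1) * card \<tau>)"
proof -
  have d: "1 \<le> d"
    using assms by simp
  \<comment> \<open>After rewriting, this concerns one fixed transition function:
    \<open>search_tree_law d\<close> is the witness, and the law is unique by its cylinder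
    probabilities.\<close>
  have "\<exists>!P. is_MERW d P"
    unfolding is_MERW_iff[OF d]
  proof (rule ex1I)
    show "is_search_tree_process d (search_tree_law d)"
      by (rule is_search_tree_process_search_tree_law[OF d])
    show "P = search_tree_law d" if "is_search_tree_process d P" for P
      using that is_search_tree_process_search_tree_law[OF d]
      unfolding is_search_tree_process_def by (rule markov_chain_law_unique)
  qed
  then show ?thesis
    using is_MERW_iff[OF d] merw_states_eq[OF d] merw_transition_eq[OF d] card_extensions[OF d]
    by simp
qed

end
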